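(* Let $\Omega$ be a regular polygon with $n$ vertices, let $\{\lambda_i\}_{i=1}^n$ be barycentric coordinates on $\Omega$, and let $\{\xi_{ij}\}_{ij\in V\cup E}$ be the functions $\xi_{ij}=\sum_{ab\in I}c^{ij}_{ab}\lambda_a\lambda_b$ constructed with the regular-polygon coefficients described in the context, namely, for each $ab\in D$, $c^{aa}_{ab}=c^{bb}_{ab}=c_0$, $c^{(a-1)a}_{ab}=c^{b(b+1)}_{ab}=c_-$, $c^{a(a+1)}_{ab}=c^{(b-1)b}_{ab}=c_+$. Then for all $\mathbf{x}\in\Omega$: (1) $\sum_{ii\in V}\xi_{ii}+\sum_{i(i+1)\in E}2\xi_{i(i+1)}=1$; (2) $\sum_{ii\in V}\mathbf{v}_{ii}\xi_{ii}+\sum_{i(i+1)\in E}2\mathbf{v}_{i(i+1)}\xi_{i(i+1)}=\mathbf{x}$; (3) $\sum_{ii\in V}\mathbf{v}_i\mathbf{v}_i^T\xi_{ii}+\sum_{i(i+1)\in E}(\mathbf{v}_i\mathbf{v}_{i+1}^T+\mathbf{v}_{i+1}\mathbf{v}_i^T)\xi_{i(i+1)}=\mathbf{x}\mathbf{x}^T$.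
   Context: Vertices $\mathbf{v}_1,\dots,\mathbf{v}_n$ of a polygon are ordered counter-clockwise and viewed as column vectors in $\mathbb{R}^2$; vertex indices are taken modulo $n$. Barycentric coordinates on $\Omega$ are functions $\lambda_i:\Omega\to\mathbb{R}$, $i=1,\dots,n$, with $\lambda_i\ge 0$ on $\Omega$ and $L=\sum_{i=1}^n L(\mathbf{v}_i)\lambda_i$ on $\Omega$ for every linear (i.e. affine, degree at most one) function $L:\Omega\to\mathbb{R}$. Index sets: $I=\{\{a,b\}: a,b\in\{1,\dots,n\}\}$ is the set of unordered, possibly non-distinct pairs; $V=\{\{a,a\}\}$, $E=\{\{a,a+1\}: a=1,\dots,n\}$, $D=I\setminus(V\cup E)$. One writes $ab$ for $\{a,b\}$, and $\mathbf{v}_{ab}:=(\mathbf{v}_a+\mathbf{v}_b)/2$ (so $\mathbf{v}_{aa}=\mathbf{v}_a$). Coefficients. For $ab\in V\cup E$: $c^{ij}_{ab}=1$ if $ij=ab$ and $c^{ij}_{ab}=0$ otherwise ($ij\in V\cup E$). For $ab\in D$: let $\sigma=2\pi/n$ be the central angle between consecutive vertices, and let $2\theta\in(0,\pi]$ be the central angle between $\mathbf{v}_a$ and $\mathbf{v}_b$, the names $a$ and $b$ being assigned so that the counter-clockwise angle from $\mathbf{v}_b$ to $\mathbf{v}_a$ about the center equals $2\theta$; thus $0<\sigma\le\theta\le\pi/2$. (Equivalently, after a similarity, $\mathbf{v}_a=(\cos\theta,\sin\theta)$, $\mathbf{v}_{a\pm1}=(\cos(\theta\pm\sigma),\sin(\theta\pm\sigma))$,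 $\mathbf{v}_b=(\cos\theta,-\sin\theta)$, $\mathbf{v}_{b-1}=(\cos(\theta+\sigma),-\sin(\theta+\sigma))$, $\mathbf{v}_{b+1}=(\cos(\theta-\sigma),-\sin(\theta-\sigma))$.) Set $$c_0=\frac{(-1+\cos\sigma)\cot\theta+(1+\cos\sigma)\tan\theta}{(-1+\cos\sigma)(\cot\theta+\tan\theta)},$$ $$c_-=\frac{\cos\sigma-\sin\sigma\tan\theta-1}{2(\tan\theta+\cot\theta)\sin\sigma(\cos\sigma-1)},\qquad c_+=\frac{1-\cos\sigma-\sin\sigma\tan\theta}{2(\tan\theta+\cot\theta)\sin\sigma(\cos\sigma-1)},$$ where for $\theta=\pi/2$ these are understood as the limits as $\theta\to\pi/2$. The six coefficients named in the claim are given these values, and all other $c^{ij}_{ab}$ with $ab\in D$ are $0$. *)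

theory Defs
  imports "HOL-Analysis.Analysis" "HOL-Library.Uprod"
begin

text \<open>
  The vertices of an n-gon are given by v restricted to the indices 1, ..., n. Index
  arithmetic is cyclic: the successor of n is 1 and the predecessor of 1 is n.
\<close>

definition nxt :: "nat \<Rightarrow> nat \<Rightarrow> nat" where
  "nxt n i = (if i = n then 1 else i + 1)"

definition prv :: "nat \<Rightarrow> nat \<Rightarrow> nat" where
  "prv n i = (if i = 1 then n else i - 1)"

definition to_complex :: "real^2 \<Rightarrow> complex" where
  "to_complex p = Complex (p $ 1) (p $ 2)"

text \<open>The counter-clockwise angle, in the interval from 0 to 2 pi (exclusive), from p to q about z.\<close>

definition ccw_angle :: "real^2 \<Rightarrow> real^2 \<Rightarrow> real^2 \<Rightarrow> real" where
  "ccw_angle z p q = Arg2pi (to_complex (q - z) / to_complex (p - z))"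

text \<open>
  Regular n-gon with centre z: the vertices lie on a circle about z, in counter-clockwise
  order, with central angle 2 pi / n between consecutive vertices. The radius r is positive
  because the central angles are nonzero.
\<close>

definition regular_polygon :: "nat \<Rightarrow> real^2 \<Rightarrow> (nat \<Rightarrow> real^2) \<Rightarrow> bool" where
  "regular_polygon n z v \<longleftrightarrow> n \<ge> 3 \<and>
     (\<exists>r. \<forall>i\<in>{1..n}. dist z (v i) = r) \<and>
     (\<forall>i\<in>{1..n}. ccw_angle z (v i) (v (nxt n i)) = 2 * pi / real n)"

definition polygon_region :: "nat \<Rightarrow> (nat \<Rightarrow> real^2) \<Rightarrow> (real^2) set" where
  "polygon_region n v = convex hull (v ` {1..n})"

text \<open>Linear precision is required for all affine functions, written as g + c with g linear.\<close>

definition barycentric_coordinates ::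
  "nat \<Rightarrow> (nat \<Rightarrow> real^2) \<Rightarrow> (real^2) set \<Rightarrow> (nat \<Rightarrow> real^2 \<Rightarrow> real) \<Rightarrow> bool" where
  "barycentric_coordinates n v \<Omega> lam \<longleftrightarrow>
     (\<forall>i\<in>{1..n}. \<forall>x\<in>\<Omega>. lam i x \<ge> 0) \<and>
     (\<forall>(g :: real^2 \<Rightarrow> real) c. linear g \<longrightarrow>
        (\<forall>x\<in>\<Omega>. g x + c = (\<Sum>i=1..n. (g (v i) + c) * lam i x)))"

definition index_pairs :: "nat \<Rightarrow> nat uprod set" where
  "index_pairs n = {Upair a b | a b. a \<in> {1..n} \<and> b \<in> {1..n}}"

definition vertex_pairs :: "nat \<Rightarrow> nat uprod set" where
  "vertex_pairs n = {Upair a a | a. a \<in> {1..n}}"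

definition edge_pairs :: "nat \<Rightarrow> nat uprod set" where
  "edge_pairs n = {Upair a (nxt n a) | a. a \<in> {1..n}}"

definition diagonal_pairs :: "nat \<Rightarrow> nat uprod set" where
  "diagonal_pairs n = index_pairs n - (vertex_pairs n \<union> edge_pairs n)"

text \<open>
  The formulas below are not meaningful at \<theta> = pi / 2 itself, where tan is not defined
  (in the library, tan (pi / 2) = 0); there they are replaced by their limits.
\<close>

definition lim_at_half_pi :: "(real \<Rightarrow> real) \<Rightarrow> real \<Rightarrow> real" where
  "lim_at_half_pi f \<theta> = (if \<theta> = pi / 2 then Lim (at (pi / 2)) f else f \<theta>)"

definition c_zero :: "real \<Rightarrow> real \<Rightarrow> real" where
  "c_zero \<sigma> = lim_at_half_pi (\<lambda>\<theta>.
     ((- 1 + cos \<sigma>) * cot \<theta> + (1 + cos \<sigma>) * tan \<theta>) /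
     ((- 1 + cos \<sigma>) * (cot \<theta> + tan \<theta>)))"

definition c_minus :: "real \<Rightarrow> real \<Rightarrow> real" where
  "c_minus \<sigma> = lim_at_half_pi (\<lambda>\<theta>.
     (cos \<sigma> - sin \<sigma> * tan \<theta> - 1) /
     (2 * (tan \<theta> + cot \<theta>) * sin \<sigma> * (cos \<sigma> - 1)))"

definition c_plus :: "real \<Rightarrow> real \<Rightarrow> real" where
  "c_plus \<sigma> = lim_at_half_pi (\<lambda>\<theta>.
     (1 - cos \<sigma> - sin \<sigma> * tan \<theta>) /
     (2 * (tan \<theta> + cot \<theta>) * sin \<sigma> * (cos \<sigma> - 1)))"

definition diagonal_coeff ::
  "nat \<Rightarrow> real^2 \<Rightarrow> (nat \<Rightarrow> real^2) \<Rightarrow> nat uprod \<Rightarrow> nat \<Rightarrow> nat \<Rightarrow> real" where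
  "diagonal_coeff n z v ij a b =
     (let \<sigma> = 2 * pi / real n; \<theta> = ccw_angle z (v b) (v a) / 2 in
      if ij = Upair a a \<or> ij = Upair b b then c_zero \<sigma> \<theta>
      else if ij = Upair (prv n a) a \<or> ij = Upair b (nxt n b) then c_minus \<sigma> \<theta>
      else if ij = Upair a (nxt n a) \<or> ij = Upair (prv n b) b then c_plus \<sigma> \<theta>
      else 0)"

text \<open>
  The names a and b of a diagonal pair are assigned so that the counter-clockwise angle from
  v b to v a lies in the interval from 0 (exclusive) to pi. Only for opposite vertices do both
  assignments qualify; since c_minus and c_plus agree at \<theta> = pi / 2, the coefficients do not
  depend on the choice.
\<close>

definition orient ::
  "real^2 \<Rightarrow> (nat \<Rightarrow> real^2) \<Rightarrow> nat uprod \<Rightarrow> nat \<times> nat" where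
  "orient z v ab = (SOME (a, b). ab = Upair a b \<and>
     0 < ccw_angle z (v b) (v a) \<and> ccw_angle z (v b) (v a) \<le> pi)"

text \<open>The coefficient with upper index ij and lower index ab.\<close>

definition coeff ::
  "nat \<Rightarrow> real^2 \<Rightarrow> (nat \<Rightarrow> real^2) \<Rightarrow> nat uprod \<Rightarrow> nat uprod \<Rightarrow> real" where
  "coeff n z v ij ab =
     (if ab \<in> diagonal_pairs n then (case orient z v ab of (a, b) \<Rightarrow> diagonal_coeff n z v ij a b)
      else if ij = ab then 1 else 0)"

lift_definition pair_product :: "('a \<Rightarrow> 'b::comm_monoid_mult) \<Rightarrow> 'a uprod \<Rightarrow> 'b"
  is "\<lambda>f (a, b). f a * f b"
  by (auto simp: mult.commute)

lemma pair_product_Upair [simp]: "pair_product f (Upair a b) = f a * f b"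
  by transfer simp

definition xi ::
  "nat \<Rightarrow> real^2 \<Rightarrow> (nat \<Rightarrow> real^2) \<Rightarrow> (nat \<Rightarrow> real^2 \<Rightarrow> real) \<Rightarrow> nat uprod \<Rightarrow> real^2 \<Rightarrow> real" where
  "xi n z v lam ij x =
     (\<Sum>ab\<in>index_pairs n. coeff n z v ij ab * pair_product (\<lambda>i. lam i x) ab)"

definition outer_product :: "real^2 \<Rightarrow> real^2 \<Rightarrow> real^2^2" where
  "outer_product p q = (columnvector p :: real^1^2) ** transpose (columnvector q :: real^1^2)"

end

theory Submission
  imports Defs
begin

text \<open>
  The three claims are instances of one: for all affine functions \<open>f\<close> and \<open>g\<close> on the plane,
  the sum of \<open>f(v\<^sub>i) g(v\<^sub>i) \<xi>\<^sub>i\<^sub>i\<close> over the vertices plus the sum of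
  \<open>(f(v\<^sub>i) g(v\<^sub>j) + f(v\<^sub>j) g(v\<^sub>i)) \<xi>\<^sub>i\<^sub>j\<close> over the edges equals \<open>f(x) g(x)\<close>.
  The choices \<open>f = g = 1\<close>, then \<open>f = 1\<close> with \<open>g\<close> a coordinate, then two coordinates give
  the constant, linear and quadratic statements.

  By linear precision, \<open>f(x) g(x)\<close> is the double sum of
  \<open>f(v\<^sub>a) g(v\<^sub>b) \<lambda>\<^sub>a(x) \<lambda>\<^sub>b(x)\<close>. Collecting, on both sides, the terms that belong to an
  unordered pair \<open>ab\<close>, it is enough that the coefficients with lower index \<open>ab\<close>, put in place
  of \<open>\<xi>\<close>, give \<open>f(v\<^sub>a) g(v\<^sub>b) + f(v\<^sub>b) g(v\<^sub>a)\<close>, or \<open>f(v\<^sub>a) g(v\<^sub>a)\<close> if \<open>a = b\<close>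
  (\<open>edge_form_coeff\<close>). For vertices and edges this is the definition of the coefficients.

  For a diagonal, six vertices are involved. Measured from the bisector of the central angle
  between \<open>v\<^sub>b\<close> and \<open>v\<^sub>a\<close>, they have polar angles \<open>\<plusminus>\<theta>\<close>, \<open>\<plusminus>(\<theta> - \<sigma>)\<close> and
  \<open>\<plusminus>(\<theta> + \<sigma>)\<close>, and an affine function restricted to the circle has the form
  \<open>p + q cos t + s sin t\<close>. The requirement becomes a trigonometric identity
  (\<open>diagonal_identity\<close>), which holds because the coefficients simplify to
  \<open>c\<^sub>0 = 1 - 2X\<close>, \<open>c\<^sub>- = (X + Y)/2\<close> and \<open>c\<^sub>+ = (X - Y)/2\<close>, where
  \<open>X (1 - cos \<sigma>) = sin\<^sup>2 \<theta>\<close> and \<open>Y sin \<sigma> = sin \<theta> cos \<theta>\<close>. These forms are continuous at \<open>\<theta> = \<pi>/2\<close>, so they also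
  give the limiting values used for opposite vertices.
\<close>

section \<open>The coefficients of a diagonal\<close>

lemma tan_cot_sum:
  fixes \<theta> :: real
  assumes "sin \<theta> \<noteq> 0" "cos \<theta> \<noteq> 0"
  shows "tan \<theta> + cot \<theta> = 1 / (sin \<theta> * cos \<theta>)"
proof -
  have "tan \<theta> + cot \<theta> = (sin \<theta> * sin \<theta> + cos \<theta> * cos \<theta>) / (sin \<theta> * cos \<theta>)"
    using assms by (simp add: tan_def cot_def add_frac_eq)
  then show ?thesis
    by (metis sin_cos_squared_add3 add.commute)
qed

text \<open>
  The original formulas are only meaningful where sine and cosine are nonzero, which includes
  a punctured neighbourhood of \<open>\<pi>/2\<close>. A continuous closed form that agrees with them there
  supplies the limit as well, so that opposite vertices need no separate treatment.
\<close>

lemma lim_at_half_pi_eqI: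
  assumes closed: "\<And>t. sin t \<noteq> 0 \<Longrightarrow> cos t \<noteq> 0 \<Longrightarrow> f t = g t"
    and cont: "isCont g (pi / 2)"
    and \<theta>: "0 < \<theta>" "\<theta> \<le> pi / 2"
  shows "lim_at_half_pi f \<theta> = g \<theta>"
proof (cases "\<theta> = pi / 2")
  case True
  have "\<forall>\<^sub>F t in at (pi / 2). t \<in> {0<..<pi} - {pi / 2}"
    by (rule eventually_at_in_open) auto
  then have "\<forall>\<^sub>F t in at (pi / 2). g t = f t"
  proof eventually_elim
    case (elim t)
    have "sin t \<noteq> 0" using elim sin_gt_zero by force
    moreover have "cos t \<noteq> 0"
      using elim cos_inj_pi[of t "pi / 2"] by auto
    ultimately show ?case using closed by simp
  qed
  then have "(f \<longlongrightarrow> g (pi / 2)) (at (pi / 2))"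
    using cont unfolding isCont_def by (rule Lim_transform_eventually[rotated])
  then show ?thesis
    unfolding True by (simp add: lim_at_half_pi_def tendsto_Lim)
next
  case False
  then have "sin \<theta> > 0" "cos \<theta> > 0"
    using \<theta> by (auto intro!: sin_gt_zero cos_gt_zero)
  then show ?thesis using False closed by (simp add: lim_at_half_pi_def)
qed

context
  fixes \<sigma> \<theta> :: real
  assumes \<sigma>: "sin \<sigma> \<noteq> 0" and \<theta>: "0 < \<theta>" "\<theta> \<le> pi / 2"
begin

lemma cos_neq_1: "cos \<sigma> \<noteq> 1"
  using \<sigma> by (metis sin_zero_norm_cos_one norm_one sin_squared_eq power_one diff_self power_eq_0_iff)

lemma c_minus_eq: "c_minus \<sigma> \<theta> = (sin \<theta> ^ 2 / (1 - cos \<sigma>) + sin \<theta> * cos \<theta> / sin \<sigma>) / 2"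
  unfolding c_minus_def
proof (rule lim_at_half_pi_eqI)
  fix t :: real assume t: "sin t \<noteq> 0" "cos t \<noteq> 0"
  show "(cos \<sigma> - sin \<sigma> * tan t - 1) / (2 * (tan t + cot t) * sin \<sigma> * (cos \<sigma> - 1)) =
      (sin t ^ 2 / (1 - cos \<sigma>) + sin t * cos t / sin \<sigma>) / 2"
    using t \<sigma> cos_neq_1 unfolding tan_cot_sum[OF t] unfolding tan_def
    by (simp add: divide_simps) (simp add: algebra_simps power2_eq_square)
qed (use \<sigma> \<theta> cos_neq_1 in \<open>auto intro!: continuous_intros\<close>)

lemma c_plus_eq: "c_plus \<sigma> \<theta> = (sin \<theta> ^ 2 / (1 - cos \<sigma>) - sin \<theta> * cos \<theta> / sin \<sigma>) / 2"
  unfolding c_plus_def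
proof (rule lim_at_half_pi_eqI)
  fix t :: real assume t: "sin t \<noteq> 0" "cos t \<noteq> 0"
  show "(1 - cos \<sigma> - sin \<sigma> * tan t) / (2 * (tan t + cot t) * sin \<sigma> * (cos \<sigma> - 1)) =
      (sin t ^ 2 / (1 - cos \<sigma>) - sin t * cos t / sin \<sigma>) / 2"
    using t \<sigma> cos_neq_1 unfolding tan_cot_sum[OF t] unfolding tan_def
    by (simp add: divide_simps) (simp add: algebra_simps power2_eq_square)
qed (use \<sigma> \<theta> cos_neq_1 in \<open>auto intro!: continuous_intros\<close>)

lemma c_zero_eq: "c_zero \<sigma> \<theta> = 1 - 2 * sin \<theta> ^ 2 / (1 - cos \<sigma>)"
  unfolding c_zero_def
proof (rule lim_at_half_pi_eqI)
  fix t :: real assume t: "sin t \<noteq> 0" "cos t \<noteq> 0"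
  have "((- 1 + cos \<sigma>) * cot t + (1 + cos \<sigma>) * tan t) / ((- 1 + cos \<sigma>) * (cot t + tan t))
      = ((- 1 + cos \<sigma>) * cos t ^ 2 + (1 + cos \<sigma>) * sin t ^ 2) / (- 1 + cos \<sigma>)"
    using t cos_neq_1 unfolding add.commute[of "cot t"] tan_cot_sum[OF t] unfolding tan_def cot_def
    by (simp add: divide_simps power2_eq_square)
  also have "\<dots> = 1 - 2 * sin t ^ 2 / (1 - cos \<sigma>)"
    using cos_neq_1 by (simp add: cos_squared_eq divide_simps) (simp add: algebra_simps)
  finally show "((- 1 + cos \<sigma>) * cot t + (1 + cos \<sigma>) * tan t) / ((- 1 + cos \<sigma>) * (cot t + tan t))
      = 1 - 2 * sin t ^ 2 / (1 - cos \<sigma>)" .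
qed (use \<theta> cos_neq_1 in \<open>auto intro!: continuous_intros\<close>)

text \<open>
  With \<open>X\<close> and \<open>Y\<close> as in the proof, the addition theorems turn both sides into polynomials in
  the sines and cosines of \<open>\<theta>\<close> and \<open>\<sigma>\<close>, and the difference vanishes modulo the two defining
  relations of \<open>X\<close> and \<open>Y\<close> and \<open>sin\<^sup>2 \<theta> + cos\<^sup>2 \<theta> = 1\<close>. The reflection \<open>t \<mapsto> -t\<close>
  exchanges the roles of \<open>a\<close> and \<open>b\<close>, so products of an even and an odd part cancel; the
  products \<open>pp'\<close>, \<open>pq'\<close>, \<open>qq'\<close> and \<open>ss'\<close> give the actual conditions on the coefficients.
\<close>

lemma diagonal_identity:
  fixes p q s p' q' s' :: real
  defines "F \<equiv> \<lambda>t. p + q * cos t + s * sin t" and "G \<equiv> \<lambda>t. p' + q' * cos t + s' * sin t"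
  shows "c_zero \<sigma> \<theta> * (F \<theta> * G \<theta> + F (- \<theta>) * G (- \<theta>))
    + c_minus \<sigma> \<theta> * ((F (\<theta> - \<sigma>) * G \<theta> + F \<theta> * G (\<theta> - \<sigma>))
        + (F (- \<theta>) * G (- \<theta> + \<sigma>) + F (- \<theta> + \<sigma>) * G (- \<theta>)))
    + c_plus \<sigma> \<theta> * ((F \<theta> * G (\<theta> + \<sigma>) + F (\<theta> + \<sigma>) * G \<theta>)
        + (F (- \<theta> - \<sigma>) * G (- \<theta>) + F (- \<theta>) * G (- \<theta> - \<sigma>)))
    = F \<theta> * G (- \<theta>) + F (- \<theta>) * G \<theta>" (is "?L = ?R")
proof -
  define X where "X = sin \<theta> ^ 2 / (1 - cos \<sigma>)"
  define Y where "Y = sin \<theta> * cos \<theta> / sin \<sigma>"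
  have c: "c_zero \<sigma> \<theta> = 1 - 2 * X" "c_minus \<sigma> \<theta> = (X + Y) / 2" "c_plus \<sigma> \<theta> = (X - Y) / 2"
    by (simp_all add: c_zero_eq c_minus_eq c_plus_eq X_def Y_def)
  have X: "X * (1 - cos \<sigma>) = sin \<theta> ^ 2" and Y: "Y * sin \<sigma> = sin \<theta> * cos \<theta>"
    using \<sigma> cos_neq_1 by (simp_all add: X_def Y_def)
  have one: "sin \<theta> ^ 2 + cos \<theta> ^ 2 = 1" by simp
  show ?thesis
    unfolding c F_def G_def cos_add sin_add cos_diff sin_diff cos_minus sin_minus
    using X Y one by algebra
qed

end

section \<open>Vertices of a regular polygon\<close>

lemma nxt_in: "i \<in> {1..n} \<Longrightarrow> nxt n i \<in> {1..n}"
  by (auto simp: nxt_def)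

lemma prv_in: "i \<in> {1..n} \<Longrightarrow> prv n i \<in> {1..n}"
  by (auto simp: prv_def)

lemma nxt_prv: "i \<in> {1..n} \<Longrightarrow> nxt n (prv n i) = i"
  by (auto simp: prv_def nxt_def)

lemma nxt_neq: "3 \<le> n \<Longrightarrow> i \<in> {1..n} \<Longrightarrow> nxt n i \<noteq> i"
  by (auto simp: nxt_def)

lemma prv_neq: "3 \<le> n \<Longrightarrow> i \<in> {1..n} \<Longrightarrow> prv n i \<noteq> i"
  by (auto simp: prv_def)

lemma edge_eq_iff:
  "3 \<le> n \<Longrightarrow> i \<in> {1..n} \<Longrightarrow> j \<in> {1..n} \<Longrightarrow>
    Upair i (nxt n i) = Upair j (nxt n j) \<longleftrightarrow> i = j"
  by (auto simp: nxt_def split: if_splits)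

lemma prv_edge_eq_iff:
  assumes "3 \<le> n" "i \<in> {1..n}" "j \<in> {1..n}"
  shows "Upair i (nxt n i) = Upair (prv n j) j \<longleftrightarrow> i = prv n j"
  using edge_eq_iff[OF assms(1,2) prv_in[OF assms(3)]] nxt_prv[OF assms(3)] by simp

lemma diagonal_pairsD:
  assumes "Upair a b \<in> diagonal_pairs n"
  shows "a \<in> {1..n}" "b \<in> {1..n}" "a \<noteq> b" "b \<noteq> nxt n a" "a \<noteq> nxt n b"
  using assms unfolding diagonal_pairs_def index_pairs_def vertex_pairs_def edge_pairs_def
  by auto

lemma to_complex_diff: "to_complex (p - q) = to_complex p - to_complex q"
  by (simp add: to_complex_def complex_eq_iff)

lemma norm_to_complex: "norm (to_complex p) = norm p"
  by (simp add: to_complex_def cmod_def norm_vec_def L2_set_def sum_2)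

text \<open>
  Two points on a circle about \<open>z\<close> differ by the rotation through the angle between them;
  this turns the angle conditions into multiplicative relations between complex numbers. The
  radius has to be nonzero because at radius zero the angle is an artefact of division by zero.
\<close>

lemma ccw_angle_rotation:
  assumes "dist z p = r" "dist z q = r" "r \<noteq> 0"
  shows "to_complex (q - z) = to_complex (p - z) * cis (ccw_angle z p q)"
proof -
  let ?w = "to_complex (q - z) / to_complex (p - z)"
  have n: "norm (to_complex (p - z)) = r" "norm (to_complex (q - z)) = r"
    using assms by (simp_all add: norm_to_complex dist_norm norm_minus_commute)
  then have "norm ?w = 1" using assms by (simp add: norm_divide)
  then have "?w = cis (ccw_angle z p q)"
    using Arg2pi_eq[of ?w] by (simp add: ccw_angle_def cis_conv_exp)
  moreover have "to_complex (p - z) \<noteq> 0" using n assms by auto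
  ultimately show ?thesis by (simp add: field_simps)
qed

locale regular_polygon_loc =
  fixes n :: nat and z :: "real^2" and v :: "nat \<Rightarrow> real^2"
  assumes regular: "regular_polygon n z v"
begin

abbreviation \<sigma> :: real where "\<sigma> \<equiv> 2 * pi / real n"

abbreviation u :: "nat \<Rightarrow> complex" where "u i \<equiv> to_complex (v i - z)"

lemma n_ge_3: "3 \<le> n"
  using regular by (simp add: regular_polygon_def)

lemma sin_\<sigma>: "sin \<sigma> \<noteq> 0"
proof -
  have "\<sigma> < pi" using n_ge_3 by (simp add: field_simps)
  moreover have "\<sigma> > 0" using n_ge_3 by simp
  ultimately show ?thesis using sin_gt_zero by force
qed

lemma rotation:
  assumes "i \<in> {1..n}" "j \<in> {1..n}"
  shows "u j = u i * cis (ccw_angle z (v i) (v j))" "u i \<noteq> 0"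
proof -
  obtain r where r: "\<And>i. i \<in> {1..n} \<Longrightarrow> dist z (v i) = r"
    and s: "\<And>i. i \<in> {1..n} \<Longrightarrow> ccw_angle z (v i) (v (nxt n i)) = \<sigma>"
    using regular unfolding regular_polygon_def by auto
  have "r \<noteq> 0"
  proof
    assume "r = 0"
    then have "v 1 = z" using r[of 1] n_ge_3 by simp
    moreover have "to_complex 0 = 0" by (simp add: to_complex_def complex_eq_iff)
    ultimately have "ccw_angle z (v 1) (v (nxt n 1)) = 0"
      by (simp add: ccw_angle_def)
    then show False using s[of 1] n_ge_3 by simp
  qed
  then show "u j = u i * cis (ccw_angle z (v i) (v j))"
    using ccw_angle_rotation r assms by blast
  show "u i \<noteq> 0"
    using \<open>r \<noteq> 0\<close> r[OF assms(1)] norm_to_complex[of "v i - z"]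
    by (metis dist_norm norm_minus_commute norm_zero)
qed

lemma u_nxt: "i \<in> {1..n} \<Longrightarrow> u (nxt n i) = u i * cis \<sigma>"
  using rotation(1)[OF _ nxt_in, of i i] regular unfolding regular_polygon_def by auto

lemma u_prv: "i \<in> {1..n} \<Longrightarrow> u (prv n i) = u i * cis (- \<sigma>)"
  using u_nxt[OF prv_in, of i] by (simp add: nxt_prv cis_mult mult.assoc)

text \<open>
  The indices are taken without a wrap-around from \<open>n\<close> to \<open>1\<close>, which is enough to compare
  any two of them. As \<open>d < n\<close>, the total angle stays below \<open>2\<pi>\<close>, and so distinct
  indices have distinct vertices.
\<close>

lemma u_add:
  assumes "1 \<le> b" "b + d \<le> n"
  shows "u (b + d) = u b * cis (real d * \<sigma>)"
  using assms(2)
proof (induction d)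
  case (Suc d)
  then have "u (b + Suc d) = u (b + d) * cis \<sigma>"
    using u_nxt[of "b + d"] assms(1) by (simp add: nxt_def)
  then show ?case using Suc by (simp add: cis_mult algebra_simps add_divide_distrib)
qed simp

lemma angle_bounds:
  assumes "0 < d" "d < n"
  shows "0 < real d * \<sigma>" "real d * \<sigma> < 2 * pi"
proof -
  have "real d * (2 * pi) < real n * (2 * pi)" using assms by (intro mult_strict_right_mono) auto
  then show "real d * \<sigma> < 2 * pi" using n_ge_3 by (simp add: field_simps)
qed (use assms in simp)

lemma ccw_angle_less:
  assumes "1 \<le> b" "b < a" "a \<le> n"
  shows "ccw_angle z (v b) (v a) = real (a - b) * \<sigma>"
    and "ccw_angle z (v a) (v b) = 2 * pi - real (a - b) * \<sigma>"
proof -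
  define d where "d = real (a - b) * \<sigma>"
  have d: "0 < d" "d < 2 * pi" using angle_bounds[of "a - b"] assms by (simp_all add: d_def)
  have ua: "u a = u b * cis d"
    using u_add[of b "a - b"] assms by (simp add: d_def)
  have u0: "u b \<noteq> 0" using rotation(2)[of b b] assms by simp
  have "Arg2pi (cis t) = t" if "0 < t" "t < 2 * pi" for t
    by (rule Arg2pi_unique[of 1]) (use that in \<open>auto simp: cis_conv_exp\<close>)
  moreover have "u a / u b = cis d" "u b / u a = cis (2 * pi - d)"
    using u0 ua by (auto simp: cis_divide[symmetric] divide_inverse)
  ultimately show "ccw_angle z (v b) (v a) = real (a - b) * \<sigma>"
    "ccw_angle z (v a) (v b) = 2 * pi - real (a - b) * \<sigma>"
    using d unfolding ccw_angle_def d_def[symmetric] by auto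
qed

text \<open>
  The angles from \<open>v\<^sub>b\<close> to \<open>v\<^sub>a\<close> and back are positive and add up to \<open>2\<pi>\<close>, so one of
  them is at most \<open>\<pi>\<close>.
\<close>

lemma orient_exists:
  assumes "a \<in> {1..n}" "b \<in> {1..n}" "a \<noteq> b"
  shows "\<exists>a' b'. Upair a b = Upair a' b' \<and>
     0 < ccw_angle z (v b') (v a') \<and> ccw_angle z (v b') (v a') \<le> pi"
  using assms
proof (induction a b rule: linorder_wlog)
  case (le b a)
  have d: "0 < real (a - b) * \<sigma>" "real (a - b) * \<sigma> < 2 * pi"
    using angle_bounds[of "a - b"] le by auto
  show ?case
  proof (cases "real (a - b) * \<sigma> \<le> pi")
    case True
    then have "0 < ccw_angle z (v b) (v a) \<and> ccw_angle z (v b) (v a) \<le> pi"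
      using d le ccw_angle_less[of b a] by simp
    then show ?thesis by (metis Upair_inject)
  next
    case False
    then have "0 < ccw_angle z (v a) (v b) \<and> ccw_angle z (v a) (v b) \<le> pi"
      using d le ccw_angle_less[of b a] by simp
    then show ?thesis by blast
  qed
next
  case (sym a b)
  then show ?case by (metis Upair_inject)
qed

lemma orient_works:
  assumes "ab \<in> diagonal_pairs n"
  obtains a b where "orient z v ab = (a, b)" "ab = Upair a b"
    "0 < ccw_angle z (v b) (v a)" "ccw_angle z (v b) (v a) \<le> pi"
proof -
  obtain a b where "ab = Upair a b" by (cases ab)
  then have "\<exists>p. case p of (a, b) \<Rightarrow> ab = Upair a b \<and>
     0 < ccw_angle z (v b) (v a) \<and> ccw_angle z (v b) (v a) \<le> pi"
    using orient_exists diagonal_pairsD[of a b n] assms by auto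
  from someI_ex[OF this] show thesis
    unfolding orient_def[symmetric] by (auto intro: that split: prod.splits)
qed


section \<open>Products of affine functions over vertices and edges\<close>

text \<open>
  The common shape of the left-hand sides of the theorem, with the functions \<open>\<xi>\<close> replaced by
  arbitrary weights so that it can also be evaluated on the coefficients of a single pair.
\<close>

definition (in -) edge_form ::
  "nat \<Rightarrow> (nat uprod \<Rightarrow> real) \<Rightarrow> (nat \<Rightarrow> real) \<Rightarrow> (nat \<Rightarrow> real) \<Rightarrow> real" where
  "edge_form n w f g = (\<Sum>i=1..n. w (Upair i i) * (f i * g i))
     + (\<Sum>i=1..n. w (Upair i (nxt n i)) * (f i * g (nxt n i) + f (nxt n i) * g i))"

text \<open>
  Values at the vertices of an affine function: every real linear functional on the plane is
  \<open>w \<mapsto> Re (k w)\<close> for a complex \<open>k\<close>, a form in which rotations act by multiplication.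
\<close>

definition affine_data :: "(nat \<Rightarrow> real) \<Rightarrow> bool" where
  "affine_data f \<longleftrightarrow> (\<exists>p k. \<forall>i\<in>{1..n}. f i = p + Re (k * u i))"

text \<open>
  The two vertices and the four edges that carry a coefficient have to be pairwise distinct,
  for otherwise the nested case distinction in \<^const>\<open>diagonal_coeff\<close> would drop a
  contribution. This is where it matters that \<open>a\<close> and \<open>b\<close> are neither equal nor adjacent.
\<close>

lemma edge_form_diagonal_coeff:
  assumes ab: "Upair a b \<in> diagonal_pairs n"
  defines "\<theta> \<equiv> ccw_angle z (v b) (v a) / 2"
  shows "edge_form n (\<lambda>ij. diagonal_coeff n z v ij a b) f g =
      c_zero \<sigma> \<theta> * (f a * g a + f b * g b)
    + c_minus \<sigma> \<theta> * ((f (prv n a) * g a + f a * g (prv n a))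
        + (f b * g (nxt n b) + f (nxt n b) * g b))
    + c_plus \<sigma> \<theta> * ((f a * g (nxt n a) + f (nxt n a) * g a)
        + (f (prv n b) * g b + f b * g (prv n b)))"
proof -
  note ab = diagonal_pairsD[OF ab]
  have V: "diagonal_coeff n z v (Upair i i) a b = (if i = a \<or> i = b then c_zero \<sigma> \<theta> else 0)"
    if "i \<in> {1..n}" for i
    unfolding diagonal_coeff_def Let_def \<theta>_def
    using nxt_neq[OF n_ge_3 ab(1)] nxt_neq[OF n_ge_3 ab(2)]
      prv_neq[OF n_ge_3 ab(1)] prv_neq[OF n_ge_3 ab(2)] by auto
  have E: "diagonal_coeff n z v (Upair i (nxt n i)) a b =
      (if i = prv n a \<or> i = b then c_minus \<sigma> \<theta>
       else if i = a \<or> i = prv n b then c_plus \<sigma> \<theta> else 0)" if i: "i \<in> {1..n}" for i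
  proof -
    have "Upair i (nxt n i) \<noteq> Upair c c" for c
      using nxt_neq[OF n_ge_3 i] by auto
    then show ?thesis
      unfolding diagonal_coeff_def Let_def \<theta>_def
      by (simp only: simp_thms if_False edge_eq_iff[OF n_ge_3 i] prv_edge_eq_iff[OF n_ge_3 i] ab)
  qed
  have dist: "prv n a \<noteq> b" "prv n a \<noteq> a" "prv n a \<noteq> prv n b" "b \<noteq> a" "b \<noteq> prv n b" "a \<noteq> prv n b"
    using ab prv_neq[OF n_ge_3 ab(1)] prv_neq[OF n_ge_3 ab(2)] nxt_prv[OF ab(1)] nxt_prv[OF ab(2)]
    by metis+
  \<comment> \<open>The edge ending at a vertex is listed under the index of its predecessor, so the edges
    with a coefficient are those of index \<open>prv n a\<close>, \<open>b\<close>, \<open>a\<close> and \<open>prv n b\<close>.\<close>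
  have "(\<Sum>i=1..n. diagonal_coeff n z v (Upair i i) a b * (f i * g i)) =
      (\<Sum>i\<in>{a, b}. diagonal_coeff n z v (Upair i i) a b * (f i * g i))"
    by (rule sum.mono_neutral_right) (use ab V in auto)
  also have "\<dots> = c_zero \<sigma> \<theta> * (f a * g a + f b * g b)"
    using ab V by (simp add: algebra_simps)
  finally have sV: "(\<Sum>i=1..n. diagonal_coeff n z v (Upair i i) a b * (f i * g i)) = \<dots>" .
  let ?h = "\<lambda>i. diagonal_coeff n z v (Upair i (nxt n i)) a b * (f i * g (nxt n i) + f (nxt n i) * g i)"
  have "sum ?h {1..n} = sum ?h {prv n a, b, a, prv n b}"
    by (rule sum.mono_neutral_right) (use ab E prv_in[OF ab(1)] prv_in[OF ab(2)] in auto)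
  also have "\<dots> = ?h (prv n a) + ?h b + ?h a + ?h (prv n b)"
    using dist by (simp add: add.assoc)
  also have "\<dots> = c_minus \<sigma> \<theta> * ((f (prv n a) * g a + f a * g (prv n a))
        + (f b * g (nxt n b) + f (nxt n b) * g b))
    + c_plus \<sigma> \<theta> * ((f a * g (nxt n a) + f (nxt n a) * g a)
        + (f (prv n b) * g b + f b * g (prv n b)))"
    using dist ab E[OF prv_in[OF ab(1)]] E[OF prv_in[OF ab(2)]] E[OF ab(1)] E[OF ab(2)]
    by (simp add: nxt_prv algebra_simps)
  finally show ?thesis
    unfolding edge_form_def sV by simp
qed

text \<open>
  Turning the polygon so that the bisector between \<open>v\<^sub>b\<close> and \<open>v\<^sub>a\<close> becomes the positive real
  axis reduces this to the trigonometric identity above.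
\<close>

lemma edge_form_diagonal:
  assumes ab: "Upair a b \<in> diagonal_pairs n"
    and angle: "0 < ccw_angle z (v b) (v a)" "ccw_angle z (v b) (v a) \<le> pi"
    and f: "affine_data f" and g: "affine_data g"
  shows "edge_form n (\<lambda>ij. diagonal_coeff n z v ij a b) f g = f a * g b + f b * g a"
proof -
  note ab' = diagonal_pairsD[OF ab]
  define \<theta> where "\<theta> = ccw_angle z (v b) (v a) / 2"
  \<comment> \<open>The point of the circle halfway from \<open>b\<close> to \<open>a\<close>: the new direction of angle zero.\<close>
  define m where "m = u b * cis \<theta>"
  have ub: "u b = m * cis (- \<theta>)"
    by (simp add: m_def cis_mult mult.assoc)
  have ua: "u a = m * cis \<theta>"
    using rotation(1)[OF ab'(2,1)] by (simp add: m_def \<theta>_def cis_mult mult.assoc)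
  have adj: "u (nxt n a) = m * cis (\<theta> + \<sigma>)" "u (prv n a) = m * cis (\<theta> - \<sigma>)"
    "u (nxt n b) = m * cis (- \<theta> + \<sigma>)" "u (prv n b) = m * cis (- \<theta> - \<sigma>)"
    using ab' by (simp_all add: u_nxt u_prv ua ub cis_mult mult.assoc)
  have local_form: "\<exists>p q s. \<forall>i\<in>{1..n}. \<forall>t. u i = m * cis t \<longrightarrow> h i = p + q * cos t + s * sin t"
    if h: "affine_data h" for h
  proof -
    obtain p k where pk: "\<And>i. i \<in> {1..n} \<Longrightarrow> h i = p + Re (k * u i)"
      using h unfolding affine_data_def by auto
    have "h i = p + Re (k * m) * cos t + (- Im (k * m)) * sin t"
      if "i \<in> {1..n}" "u i = m * cis t" for i t
      using pk[OF that(1)] unfolding that(2) mult.assoc[symmetric] by (simp add: algebra_simps)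
    then show ?thesis by blast
  qed
  obtain p q s where F: "\<And>i t. i \<in> {1..n} \<Longrightarrow> u i = m * cis t \<Longrightarrow> f i = p + q * cos t + s * sin t"
    using local_form[OF f] by blast
  obtain p' q' s' where G: "\<And>i t. i \<in> {1..n} \<Longrightarrow> u i = m * cis t \<Longrightarrow> g i = p' + q' * cos t + s' * sin t"
    using local_form[OF g] by blast
  note ins = ab'(1,2) nxt_in[OF ab'(1)] nxt_in[OF ab'(2)] prv_in[OF ab'(1)] prv_in[OF ab'(2)]
  note vals = F[OF ins(1) ua] F[OF ins(2) ub] F[OF ins(3) adj(1)] F[OF ins(4) adj(3)]
    F[OF ins(5) adj(2)] F[OF ins(6) adj(4)]
    G[OF ins(1) ua] G[OF ins(2) ub] G[OF ins(3) adj(1)] G[OF ins(4) adj(3)]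
    G[OF ins(5) adj(2)] G[OF ins(6) adj(4)]
  show ?thesis
    unfolding edge_form_diagonal_coeff[OF ab] \<theta>_def[symmetric] vals
    by (rule diagonal_identity[OF sin_\<sigma>]) (use angle in \<open>simp_all add: \<theta>_def\<close>)
qed

text \<open>
  The right-hand side is \<open>f a * g b + f b * g a\<close>, or \<open>f a * g a\<close> for a vertex. As a sum over
  the ordered pairs that represent \<open>ab\<close> it covers both cases and matches the double sum into
  which the product of two barycentric expansions unfolds.
\<close>

lemma edge_form_coeff:
  assumes ab: "ab \<in> index_pairs n" and f: "affine_data f" and g: "affine_data g"
  shows "edge_form n (\<lambda>ij. coeff n z v ij ab) f g =
    (\<Sum>(a, b) \<in> {c \<in> {1..n} \<times> {1..n}. (\<lambda>(a, b). Upair a b) c = ab}. f a * g b)"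
    (is "?L = sum _ ?P")
proof -
  have P: "?P = {(a, b), (b, a)}" if "ab = Upair a b" "a \<in> {1..n}" "b \<in> {1..n}" for a b
    using that by auto
  consider "ab \<in> diagonal_pairs n" | "ab \<in> vertex_pairs n" "ab \<notin> diagonal_pairs n"
    | "ab \<in> edge_pairs n" "ab \<notin> diagonal_pairs n"
    using ab by (auto simp: diagonal_pairs_def)
  then show ?thesis
  proof cases
    case 1
    obtain a b where o: "orient z v ab = (a, b)" "ab = Upair a b"
      "0 < ccw_angle z (v b) (v a)" "ccw_angle z (v b) (v a) \<le> pi"
      using orient_works[OF 1] by blast
    note d = diagonal_pairsD[OF 1[unfolded o(2)]]
    have "?L = f a * g b + f b * g a"
      using edge_form_diagonal[OF 1[unfolded o(2)] o(3,4) f g] 1 o(1) by (simp add: coeff_def)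
    also have "\<dots> = sum (\<lambda>(a, b). f a * g b) ?P"
      unfolding P[OF o(2) d(1,2)] using d(3) by simp
    finally show ?thesis .
  next
    case 2
    then obtain a where a: "ab = Upair a a" "a \<in> {1..n}" by (auto simp: vertex_pairs_def)
    have "coeff n z v ij ab = (if ij = ab then 1 else 0)" for ij
      using 2(2) by (simp add: coeff_def)
    then have "?L = (\<Sum>i=1..n. if i = a then f a * g a else 0) + (\<Sum>i=1..n. 0)"
      unfolding edge_form_def a(1) using nxt_neq[OF n_ge_3]
      by (intro arg_cong2[where f = "(+)"] sum.cong) auto
    also have "\<dots> = f a * g a" using a(2) by simp
    finally show ?thesis unfolding P[OF a a(2)] by simp
  next
    case 3
    then obtain a where a: "ab = Upair a (nxt n a)" "a \<in> {1..n}" by (auto simp: edge_pairs_def)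
    have "coeff n z v ij ab = (if ij = ab then 1 else 0)" for ij
      using 3(2) by (simp add: coeff_def)
    then have "?L = (\<Sum>i=1..n. 0)
        + (\<Sum>i=1..n. if i = a then f a * g (nxt n a) + f (nxt n a) * g a else 0)"
      unfolding edge_form_def a(1)
      using nxt_neq[OF n_ge_3 a(2)] edge_eq_iff[OF n_ge_3 _ a(2)]
      by (intro arg_cong2[where f = "(+)"] sum.cong) (simp_all del: Upair_inject, simp)
    also have "\<dots> = f a * g (nxt n a) + f (nxt n a) * g a" using a(2) by simp
    finally show ?thesis
      unfolding P[OF a nxt_in[OF a(2)]] using nxt_neq[OF n_ge_3 a(2)] by simp
  qed
qed

lemma (in -) index_pairs_eq: "index_pairs n = (\<lambda>(a, b). Upair a b) ` ({1..n} \<times> {1..n})"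
  by (fastforce simp: index_pairs_def image_iff)

lemma edge_form_sum:
  "edge_form n (\<lambda>ij. \<Sum>k\<in>K. w ij k * c k) f g = (\<Sum>k\<in>K. c k * edge_form n (\<lambda>ij. w ij k) f g)"
proof -
  have swap: "(\<Sum>i=1..n. (\<Sum>k\<in>K. w (e i) k * c k) * h i) =
      (\<Sum>k\<in>K. c k * (\<Sum>i=1..n. w (e i) k * h i))" for e :: "nat \<Rightarrow> nat uprod" and h
    unfolding sum_distrib_left sum_distrib_right
    by (subst sum.swap) (simp only: ac_simps)
  show ?thesis
    unfolding edge_form_def swap distrib_left sum.distrib ..
qed

text \<open>
  Interchanging the sums over the weights and over the pairs leaves one instance of the
  preceding identity for each pair; the fibres of \<^const>\<open>Upair\<close> then reassemble into the full
  square of index pairs, over which the sum factorises.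
\<close>

lemma edge_form_xi:
  assumes f: "affine_data f" and g: "affine_data g"
  shows "edge_form n (\<lambda>ij. xi n z v lam ij x) f g =
    (\<Sum>i=1..n. f i * lam i x) * (\<Sum>i=1..n. g i * lam i x)"
proof -
  let ?U = "\<lambda>(a, b). Upair a b"
  have "edge_form n (\<lambda>ij. xi n z v lam ij x) f g =
      (\<Sum>ab\<in>index_pairs n. pair_product (\<lambda>i. lam i x) ab * edge_form n (\<lambda>ij. coeff n z v ij ab) f g)"
    unfolding xi_def by (rule edge_form_sum)
  also have "\<dots> = (\<Sum>ab\<in>index_pairs n. \<Sum>(a, b)\<in>{c \<in> {1..n} \<times> {1..n}. ?U c = ab}.
      (f a * lam a x) * (g b * lam b x))"
    by (intro sum.cong refl, subst edge_form_coeff[OF _ f g])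
       (auto simp: sum_distrib_left intro!: sum.cong)
  also have "\<dots> = (\<Sum>(a, b)\<in>{1..n} \<times> {1..n}. (f a * lam a x) * (g b * lam b x))"
    unfolding index_pairs_eq by (rule sum.image_gen[symmetric]) simp
  also have "\<dots> = (\<Sum>i=1..n. f i * lam i x) * (\<Sum>i=1..n. g i * lam i x)"
    by (simp add: sum_product sum.cartesian_product)
  finally show ?thesis .
qed

lemma affine_data_vertices:
  fixes l :: "real^2 \<Rightarrow> real"
  assumes "linear l"
  shows "affine_data (\<lambda>i. l (v i) + c)"
proof -
  interpret l: linear l by fact
  have "l (v i) + c = (l z + c) + Re (Complex (l (axis 1 1)) (- l (axis 2 1)) * u i)" for i
  proof -
    have "v i - z = (v i - z) $ 1 *\<^sub>R axis 1 1 + (v i - z) $ 2 *\<^sub>R axis 2 1"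
      by (simp add: vec_eq_iff forall_2 axis_def)
    then have "l (v i - z) = (v i - z) $ 1 * l (axis 1 1) + (v i - z) $ 2 * l (axis 2 1)"
      by (metis l.add l.scale real_scaleR_def)
    then show ?thesis
      by (simp add: l.diff to_complex_def algebra_simps)
  qed
  then show ?thesis unfolding affine_data_def by blast
qed

lemma edge_form_barycentric:
  fixes f g :: "real^2 \<Rightarrow> real"
  assumes lam: "barycentric_coordinates n v \<Omega> lam" and x: "x \<in> \<Omega>"
    and f: "linear f" and g: "linear g"
  shows "edge_form n (\<lambda>ij. xi n z v lam ij x) (\<lambda>i. f (v i) + c) (\<lambda>i. g (v i) + d) =
    (f x + c) * (g x + d)"
proof -
  have "l x + c = (\<Sum>i=1..n. (l (v i) + c) * lam i x)" if "linear l" for l c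
    using lam x that unfolding barycentric_coordinates_def by blast
  then show ?thesis
    using edge_form_xi[OF affine_data_vertices[OF f] affine_data_vertices[OF g]] f g by simp
qed

end

lemma outer_product_nth: "outer_product p q $ i $ j = p $ i * q $ j"
  by (simp add: outer_product_def columnvector_def matrix_matrix_mult_def transpose_def)

theorem theorem4p3:
  fixes n :: nat and z :: "real^2" and v :: "nat \<Rightarrow> real^2"
    and \<Omega> :: "(real^2) set" and lam :: "nat \<Rightarrow> real^2 \<Rightarrow> real" and \<xi> :: "nat uprod \<Rightarrow> real^2 \<Rightarrow> real"
  assumes "regular_polygon n z v"
    and "\<Omega> = polygon_region n v"
    and "barycentric_coordinates n v \<Omega> lam"
    and "\<And>ij x. ij \<in> vertex_pairs n \<union> edge_pairs n \<Longrightarrow> x \<in> \<Omega> \<Longrightarrow> \<xi> ij x = xi n z v lam ij x"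
  shows "\<forall>x\<in>\<Omega>.
      (\<Sum>i=1..n. \<xi> (Upair i i) x) + (\<Sum>i=1..n. 2 * \<xi> (Upair i (nxt n i)) x) = 1 \<and>
      (\<Sum>i=1..n. \<xi> (Upair i i) x *\<^sub>R midpoint (v i) (v i))
        + (\<Sum>i=1..n. (2 * \<xi> (Upair i (nxt n i)) x) *\<^sub>R midpoint (v i) (v (nxt n i))) = x \<and>
      (\<Sum>i=1..n. \<xi> (Upair i i) x *\<^sub>R outer_product (v i) (v i))
        + (\<Sum>i=1..n. \<xi> (Upair i (nxt n i)) x *\<^sub>R
            (outer_product (v i) (v (nxt n i)) + outer_product (v (nxt n i)) (v i)))
        = outer_product x x"
proof
  fix x assume x: "x \<in> \<Omega>"
  interpret regular_polygon_loc n z v by unfold_locales fact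
  have "edge_form n (\<lambda>ij. \<xi> ij x) f g = edge_form n (\<lambda>ij. xi n z v lam ij x) f g" for f g
    unfolding edge_form_def
    by (intro arg_cong2[where f = "(+)"] sum.cong refl)
       (use assms(4) x in \<open>auto simp: vertex_pairs_def edge_pairs_def\<close>)
  then have main: "edge_form n (\<lambda>ij. \<xi> ij x) (\<lambda>i. f (v i) + c) (\<lambda>i. g (v i) + d) =
      (f x + c) * (g x + d)" if "linear f" "linear g" for f g :: "real^2 \<Rightarrow> real" and c d
    using edge_form_barycentric[OF assms(3) x that] by simp
  have zero: "linear (\<lambda>y :: real^2. 0 :: real)" by (simp add: linear_iff)
  have comp: "linear (\<lambda>y :: real^2. y $ k)" for k by (simp add: linear_iff)
  have 1: "(\<Sum>i=1..n. \<xi> (Upair i i) x) + (\<Sum>i=1..n. 2 * \<xi> (Upair i (nxt n i)) x) = 1"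
    using main[OF zero zero, of 1 1] by (simp add: edge_form_def mult.commute)
  have 2: "(\<Sum>i=1..n. \<xi> (Upair i i) x *\<^sub>R midpoint (v i) (v i))
        + (\<Sum>i=1..n. (2 * \<xi> (Upair i (nxt n i)) x) *\<^sub>R midpoint (v i) (v (nxt n i))) = x"
    unfolding vec_eq_iff
  proof
    fix k
    show "((\<Sum>i=1..n. \<xi> (Upair i i) x *\<^sub>R midpoint (v i) (v i))
        + (\<Sum>i=1..n. (2 * \<xi> (Upair i (nxt n i)) x) *\<^sub>R midpoint (v i) (v (nxt n i)))) $ k = x $ k"
      using main[OF zero comp[of k], of 1 0]
      by (simp add: edge_form_def midpoint_def algebra_simps)
  qed
  have 3: "(\<Sum>i=1..n. \<xi> (Upair i i) x *\<^sub>R outer_product (v i) (v i))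
        + (\<Sum>i=1..n. \<xi> (Upair i (nxt n i)) x *\<^sub>R
            (outer_product (v i) (v (nxt n i)) + outer_product (v (nxt n i)) (v i)))
        = outer_product x x"
    unfolding vec_eq_iff
  proof (intro allI)
    fix k l
    show "((\<Sum>i=1..n. \<xi> (Upair i i) x *\<^sub>R outer_product (v i) (v i))
        + (\<Sum>i=1..n. \<xi> (Upair i (nxt n i)) x *\<^sub>R
            (outer_product (v i) (v (nxt n i)) + outer_product (v (nxt n i)) (v i)))) $ k $ l
        = outer_product x x $ k $ l"
      using main[OF comp[of k] comp[of l], of 0 0]
      by (simp add: edge_form_def outer_product_nth)
  qed
  from 1 2 3 show "(\<Sum>i=1..n. \<xi> (Upair i i) x) + (\<Sum>i=1..n. 2 * \<xi> (Upair i (nxt n i)) x) = 1 \<and>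
      (\<Sum>i=1..n. \<xi> (Upair i i) x *\<^sub>R midpoint (v i) (v i))
        + (\<Sum>i=1..n. (2 * \<xi> (Upair i (nxt n i)) x) *\<^sub>R midpoint (v i) (v (nxt n i))) = x \<and>
      (\<Sum>i=1..n. \<xi> (Upair i i) x *\<^sub>R outer_product (v i) (v i))
        + (\<Sum>i=1..n. \<xi> (Upair i (nxt n i)) x *\<^sub>R
            (outer_product (v i) (v (nxt n i)) + outer_product (v (nxt n i)) (v i)))
        = outer_product x x"
    by blast
qed

end
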